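(* Let $(X,\Delta,\epsilon,\mu)$ be a heap object in a (strict) symmetric monoidal category $\mathcal C$. Then $(X,\Delta,\epsilon,\mu)$ is also a ternary self-distributive object in $\mathcal C$.
   Context: $\mathcal C$ has tensor product $\boxtimes$, unit object $I$, and symmetry (switching morphism) $\tau$; all symmetric monoidal categories are strict. $\mathbb 1$ denotes identity morphisms. A heap object in $\mathcal C$ is a comonoid object $(X,\Delta,\epsilon)$, with counit $\epsilon:X\to I$, endowed with a morphism of comonoids $\mu:X^{\boxtimes3}\to X$ such that: (para-associativity) $\mu(\mu\boxtimes\mathbb 1^{\boxtimes2})=\mu(\mathbb 1\boxtimes\mu\boxtimes\mathbb 1)\tau_{321}=\mu(\mathbb 1^{\boxtimes2}\boxtimes\mu)$ as morphisms $X^{\boxtimes5}\to X$, where $\tau_{321}=(\mathbb 1\boxtimes\tau\boxtimes\mathbb 1^{\boxtimes2})(\mathbb 1^{\boxtimes2}\boxtimes\tau\boxtimes\mathbb 1)(\mathbb 1\boxtimes\tau\boxtimes\mathbb 1^{\boxtimes2})$; (degeneracy) $\mu(\mathbb 1\boxtimes\Delta)=\mathbb 1\boxtimes\epsilon$ and $\mu(\Delta\boxtimes\mathbb 1)=\epsilon\boxtimes\mathbb 1$ as morphisms $X\boxtimes X\to X$. A ternary self-distributive object in $\mathcal C$ is a comonoid object $(X,\Delta,\epsilon)$ with a morphism $\mu:X^{\boxtimes3}\to X$ such that, as morphisms $X^{\boxtimes5}\to X$, $$\mu\,(\mu^{\boxtimes3})\,\sigma_3\,\bigl[\mathbb 1^{\boxtimes3}\boxtimes(\Delta'\boxtimes\mathbb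 1)\Delta\boxtimes(\Delta'\boxtimes\mathbb 1)\Delta\bigr]=\mu(\mu\boxtimes\mathbb 1^{\boxtimes2}),$$ where $\Delta'=\tau\Delta$ and $\sigma_3:X^{\boxtimes9}\to X^{\boxtimes9}$ is the composition of switching morphisms corresponding to the product of transpositions $(2\;4)(3\;7)(6\;8)$ of the tensor factors. *)

theory Defs
  imports "HOL-Combinatorics.Transposition"
begin

record ('o, 'm) smc =
  Obj :: "'o set"
  Arr :: "'m set"
  Dom :: "'m \<Rightarrow> 'o"
  Cod :: "'m \<Rightarrow> 'o"
  Id :: "'o \<Rightarrow> 'm" ("\<one>\<index>")
  Comp :: "'m \<Rightarrow> 'm \<Rightarrow> 'm" (infixr "\<cdot>\<index>" 60)
  TensorObj :: "'o \<Rightarrow> 'o \<Rightarrow> 'o" (infixr "\<odot>\<index>" 70)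
  TensorArr :: "'m \<Rightarrow> 'm \<Rightarrow> 'm" (infixr "\<otimes>\<index>" 70)
  UnitObj :: "'o" ("\<I>\<index>")
  Switch :: "'o \<Rightarrow> 'o \<Rightarrow> 'm" ("\<tau>\<index>")

definition in_hom :: "('o, 'm, 'z) smc_scheme \<Rightarrow> 'm \<Rightarrow> 'o \<Rightarrow> 'o \<Rightarrow> bool" where
  "in_hom C f A B \<longleftrightarrow> f \<in> Arr C \<and> Dom C f = A \<and> Cod C f = B"

text \<open>The composite \<open>g \<cdot> f\<close> means \<open>g\<close> after \<open>f\<close>. The operations are total functions whose
  values are only constrained on objects and on composable arrows.\<close>

locale category =
  fixes C :: "('o, 'm, 'z) smc_scheme" (structure)
  assumes dom_obj: "f \<in> Arr C \<Longrightarrow> Dom C f \<in> Obj C"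
    and cod_obj: "f \<in> Arr C \<Longrightarrow> Cod C f \<in> Obj C"
    and id_hom: "A \<in> Obj C \<Longrightarrow> in_hom C (\<one> A) A A"
    and comp_hom: "in_hom C f A B \<Longrightarrow> in_hom C g B D \<Longrightarrow> in_hom C (g \<cdot> f) A D"
    and id_left: "in_hom C f A B \<Longrightarrow> \<one> B \<cdot> f = f"
    and id_right: "in_hom C f A B \<Longrightarrow> f \<cdot> \<one> A = f"
    and comp_assoc: "in_hom C f A B \<Longrightarrow> in_hom C g B D \<Longrightarrow> in_hom C h D E
      \<Longrightarrow> (h \<cdot> g) \<cdot> f = h \<cdot> (g \<cdot> f)"

locale strict_monoidal_category = category C
  for C :: "('o, 'm, 'z) smc_scheme" (structure) +
  assumes tensor_obj: "A \<in> Obj C \<Longrightarrow> B \<in> Obj C \<Longrightarrow> A \<odot> B \<in> Obj C"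
    and unit_obj: "\<I> \<in> Obj C"
    and tensor_hom: "in_hom C f A B \<Longrightarrow> in_hom C g A' B' \<Longrightarrow> in_hom C (f \<otimes> g) (A \<odot> A') (B \<odot> B')"
    and tensor_id: "A \<in> Obj C \<Longrightarrow> B \<in> Obj C \<Longrightarrow> \<one> A \<otimes> \<one> B = \<one> (A \<odot> B)"
    and tensor_comp: "in_hom C f A B \<Longrightarrow> in_hom C g B D
      \<Longrightarrow> in_hom C f' A' B' \<Longrightarrow> in_hom C g' B' D'
      \<Longrightarrow> (g \<cdot> f) \<otimes> (g' \<cdot> f') = (g \<otimes> g') \<cdot> (f \<otimes> f')"
    and tensor_obj_assoc: "A \<in> Obj C \<Longrightarrow> B \<in> Obj C \<Longrightarrow> D \<in> Obj C
      \<Longrightarrow> (A \<odot> B) \<odot> D = A \<odot> (B \<odot> D)"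
    and tensor_obj_unit_left: "A \<in> Obj C \<Longrightarrow> \<I> \<odot> A = A"
    and tensor_obj_unit_right: "A \<in> Obj C \<Longrightarrow> A \<odot> \<I> = A"
    and tensor_assoc: "f \<in> Arr C \<Longrightarrow> g \<in> Arr C \<Longrightarrow> h \<in> Arr C
      \<Longrightarrow> (f \<otimes> g) \<otimes> h = f \<otimes> (g \<otimes> h)"
    and tensor_unit_left: "f \<in> Arr C \<Longrightarrow> \<one> \<I> \<otimes> f = f"
    and tensor_unit_right: "f \<in> Arr C \<Longrightarrow> f \<otimes> \<one> \<I> = f"

text \<open>One hexagon suffices: the other one and \<open>\<tau> A \<I> = \<one> A = \<tau> \<I> A\<close> follow from it together
  with the symmetry axiom.\<close>

locale strict_symmetric_monoidal_category = strict_monoidal_category C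
  for C :: "('o, 'm, 'z) smc_scheme" (structure) +
  assumes switch_hom: "A \<in> Obj C \<Longrightarrow> B \<in> Obj C \<Longrightarrow> in_hom C (\<tau> A B) (A \<odot> B) (B \<odot> A)"
    and switch_natural: "in_hom C f A B \<Longrightarrow> in_hom C g A' B'
      \<Longrightarrow> \<tau> B B' \<cdot> (f \<otimes> g) = (g \<otimes> f) \<cdot> \<tau> A A'"
    and switch_symmetric: "A \<in> Obj C \<Longrightarrow> B \<in> Obj C \<Longrightarrow> \<tau> B A \<cdot> \<tau> A B = \<one> (A \<odot> B)"
    and switch_hexagon: "A \<in> Obj C \<Longrightarrow> B \<in> Obj C \<Longrightarrow> D \<in> Obj C
      \<Longrightarrow> \<tau> (A \<odot> B) D = (\<tau> A D \<otimes> \<one> B) \<cdot> (\<one> A \<otimes> \<tau> B D)"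

text \<open>\<open>[i..<j] @ rev [i..<j - 1]\<close> is the palindromic word for the transposition of the positions
  \<open>i < j\<close> in adjacent transpositions, where the letter \<open>k\<close> exchanges positions \<open>k\<close> and \<open>k + 1\<close>.\<close>

definition transposition_word :: "nat \<Rightarrow> nat \<Rightarrow> nat list" where
  "transposition_word i j = [i..<j] @ rev [i..<j - 1]"

lemma transposition_word_correct:
  "i < j \<Longrightarrow> foldr (\<lambda>k p. transpose k (Suc k) \<circ> p) (transposition_word i j) id = transpose i j"
proof (induction "j - i" arbitrary: i)
  case 0
  then show ?case by simp
next
  case (Suc d)
  show ?case
  proof (cases "Suc i = j")
    case True
    then show ?thesis by (auto simp: transposition_word_def)
  next
    case False
    with Suc.prems have lt: "Suc i < j" by simp
    have word: "transposition_word i j = i # transposition_word (Suc i) j @ [i]"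
      using lt by (simp add: transposition_word_def upt_rec[of i])
    have push: "foldr (\<lambda>k p. transpose k (Suc k) \<circ> p) w q
        = foldr (\<lambda>k p. transpose k (Suc k) \<circ> p) w id \<circ> q" for w and q :: "nat \<Rightarrow> nat"
      by (induction w) (simp_all add: comp_assoc)
    have IH: "foldr (\<lambda>k p. transpose k (Suc k) \<circ> p) (transposition_word (Suc i) j) id
        = transpose (Suc i) j"
      using Suc.hyps lt by simp
    have "foldr (\<lambda>k p. transpose k (Suc k) \<circ> p) (transposition_word i j) id
        = transpose i (Suc i) \<circ> (transpose (Suc i) j \<circ> transpose i (Suc i))"
      by (simp add: word push[of _ "transpose i (Suc i)"] IH)
    also have "\<dots> = transpose i j"
      using lt by (auto simp: fun_eq_iff transpose_def)
    finally show ?thesis .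
  qed
qed

context strict_symmetric_monoidal_category
begin

primrec power_obj :: "'o \<Rightarrow> nat \<Rightarrow> 'o" where
  "power_obj X 0 = \<I>"
| "power_obj X (Suc n) = X \<odot> power_obj X n"

definition id_power :: "'o \<Rightarrow> nat \<Rightarrow> 'm" where
  "id_power X n = \<one> (power_obj X n)"

text \<open>Tensor factors are numbered from 1, so \<open>1 \<le> k < n\<close> in \<open>adjacent_switch X n k\<close> and
  \<open>1 \<le> i < j \<le> n\<close> in \<open>transposition_arrow X n i j\<close>.\<close>

definition adjacent_switch :: "'o \<Rightarrow> nat \<Rightarrow> nat \<Rightarrow> 'm" where
  "adjacent_switch X n k = id_power X (k - 1) \<otimes> \<tau> X X \<otimes> id_power X (n - k - 1)"

definition transposition_arrow :: "'o \<Rightarrow> nat \<Rightarrow> nat \<Rightarrow> nat \<Rightarrow> 'm" where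
  "transposition_arrow X n i j =
     foldr (\<lambda>k f. adjacent_switch X n k \<cdot> f) (transposition_word i j) (id_power X n)"

definition sigma3 :: "'o \<Rightarrow> 'm" where
  "sigma3 X = transposition_arrow X 9 2 4 \<cdot> transposition_arrow X 9 3 7 \<cdot> transposition_arrow X 9 6 8"

definition tau321 :: "'o \<Rightarrow> 'm" where
  "tau321 X = (\<one> X \<otimes> \<tau> X X \<otimes> id_power X 2) \<cdot> (id_power X 2 \<otimes> \<tau> X X \<otimes> \<one> X)
     \<cdot> (\<one> X \<otimes> \<tau> X X \<otimes> id_power X 2)"

text \<open>Comultiplication and counit of the tensor product of the comonoids
  \<open>(X, \<Delta>, \<epsilon>)\<close> and \<open>(Y, \<Delta>', \<epsilon>')\<close>.\<close>

definition tensor_comult :: "'o \<Rightarrow> 'm \<Rightarrow> 'o \<Rightarrow> 'm \<Rightarrow> 'm" where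
  "tensor_comult X \<Delta> Y \<Delta>' = (\<one> X \<otimes> \<tau> X Y \<otimes> \<one> Y) \<cdot> (\<Delta> \<otimes> \<Delta>')"

definition tensor_counit :: "'m \<Rightarrow> 'm \<Rightarrow> 'm" where
  "tensor_counit \<epsilon> \<epsilon>' = \<epsilon> \<otimes> \<epsilon>'"

definition comonoid_morphism :: "'o \<Rightarrow> 'm \<Rightarrow> 'm \<Rightarrow> 'o \<Rightarrow> 'm \<Rightarrow> 'm \<Rightarrow> 'm \<Rightarrow> bool" where
  "comonoid_morphism X \<Delta> \<epsilon> Y \<Delta>' \<epsilon>' f \<longleftrightarrow>
     in_hom C f X Y \<and> \<Delta>' \<cdot> f = (f \<otimes> f) \<cdot> \<Delta> \<and> \<epsilon>' \<cdot> f = \<epsilon>"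

end

locale comonoid_object = strict_symmetric_monoidal_category C
  for C :: "('o, 'm, 'z) smc_scheme" (structure) +
  fixes X :: 'o and \<Delta> \<epsilon> :: 'm
  assumes carrier_obj: "X \<in> Obj C"
    and comult_hom: "in_hom C \<Delta> X (X \<odot> X)"
    and counit_hom: "in_hom C \<epsilon> X \<I>"
    and coassociative: "(\<Delta> \<otimes> \<one> X) \<cdot> \<Delta> = (\<one> X \<otimes> \<Delta>) \<cdot> \<Delta>"
    and counit_left: "(\<epsilon> \<otimes> \<one> X) \<cdot> \<Delta> = \<one> X"
    and counit_right: "(\<one> X \<otimes> \<epsilon>) \<cdot> \<Delta> = \<one> X"

locale heap_object = comonoid_object C X \<Delta> \<epsilon>
  for C :: "('o, 'm, 'z) smc_scheme" (structure) and X :: 'o and \<Delta> \<epsilon> :: 'm +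
  fixes \<mu> :: 'm
  assumes mult_comonoid_morphism:
      "comonoid_morphism (X \<odot> X \<odot> X)
         (tensor_comult X \<Delta> (X \<odot> X) (tensor_comult X \<Delta> X \<Delta>))
         (tensor_counit \<epsilon> (tensor_counit \<epsilon> \<epsilon>))
         X \<Delta> \<epsilon> \<mu>"
    and para_associative_left:
      "\<mu> \<cdot> (\<mu> \<otimes> id_power X 2) = \<mu> \<cdot> (\<one> X \<otimes> \<mu> \<otimes> \<one> X) \<cdot> tau321 X"
    and para_associative_right:
      "\<mu> \<cdot> (\<one> X \<otimes> \<mu> \<otimes> \<one> X) \<cdot> tau321 X = \<mu> \<cdot> (id_power X 2 \<otimes> \<mu>)"
    and degeneracy_right: "\<mu> \<cdot> (\<one> X \<otimes> \<Delta>) = \<one> X \<otimes> \<epsilon>"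
    and degeneracy_left: "\<mu> \<cdot> (\<Delta> \<otimes> \<one> X) = \<epsilon> \<otimes> \<one> X"

locale ternary_self_distributive_object = comonoid_object C X \<Delta> \<epsilon>
  for C :: "('o, 'm, 'z) smc_scheme" (structure) and X :: 'o and \<Delta> \<epsilon> :: 'm +
  fixes \<mu> :: 'm
  assumes mult_hom: "in_hom C \<mu> (X \<odot> X \<odot> X) X"
    and self_distributive:
      "let \<Delta>' = \<tau> X X \<cdot> \<Delta> in
         \<mu> \<cdot> (\<mu> \<otimes> \<mu> \<otimes> \<mu>) \<cdot> sigma3 X
           \<cdot> (id_power X 3 \<otimes> ((\<Delta>' \<otimes> \<one> X) \<cdot> \<Delta>) \<otimes> ((\<Delta>' \<otimes> \<one> X) \<cdot> \<Delta>))
         = \<mu> \<cdot> (\<mu> \<otimes> id_power X 2)"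

end

theory Submission
  imports Defs
begin

text \<open>Write \<open>[x, y, z]\<close> for \<open>\<mu>\<close> and \<open>u \<mapsto> u\<^sub>1 \<otimes> u\<^sub>2 \<otimes> u\<^sub>3\<close> for the iterated comultiplication.
  Self-distributivity says
  \<open>[[x, u\<^sub>2, v\<^sub>2], [y, u\<^sub>1, v\<^sub>1], [z, u\<^sub>3, v\<^sub>3]] = [[x, y, z], u, v]\<close>,
  and para-associativity says
  \<open>[[a, b, c], d, e] = [a, [d, c, b], e] = [a, b, [c, d, e]]\<close>.
  Applying the outer equality of para-associativity and then the middle one turns the left-hand side
  into the right-nested product
  \<open>[x, u\<^sub>2, [v\<^sub>2, v\<^sub>1, [u\<^sub>1, y, [z, u\<^sub>3, v\<^sub>3]]]]\<close>.
  If the adjacent pair \<open>v\<^sub>2, v\<^sub>1\<close> can be deleted, what remains is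
  \<open>[x, u\<^sub>2, [u\<^sub>1, y, [z, u\<^sub>3, v]]] = [[x, u\<^sub>2, u\<^sub>1], y, [z, u\<^sub>3, v]]\<close>,
  and deleting \<open>u\<^sub>2, u\<^sub>1\<close> as well leaves \<open>[x, y, [z, u, v]] = [[x, y, z], u, v]\<close>.

  The degeneracy axioms delete only pairs in the order \<open>v\<^sub>1, v\<^sub>2\<close>, and cocommutativity of
  \<open>\<Delta>\<close> is not among the axioms. The point of the proof is that the opposite order is deleted too:
  \<open>[v\<^sub>2, v\<^sub>1, z] = \<epsilon>(v) z\<close> and \<open>[x, u\<^sub>2, u\<^sub>1] = \<epsilon>(u) x\<close>
  (\<open>op_degenerate_left\<close>, \<open>op_degenerate_right\<close>). Indeed
  \<open>[x, y, [v\<^sub>2, v\<^sub>1, z]] = [x, [v\<^sub>1, v\<^sub>2, y], z] = \<epsilon>(v) [x, y, z]\<close> by the middle equality, and the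
  operation \<open>[x, y, -]\<close> can be cancelled (\<open>mult_third_slot_cancel\<close>): put \<open>x\<^sub>1, x\<^sub>2\<close> in the first
  two slots and use degeneracy and the counit. The other identity is the mirror image.

  The categorical form of the argument also has to follow the permutations of tensor factors. A
  morphism between tensor powers of \<open>X\<close> is a composite of layers \<open>\<one> \<otimes> f \<otimes> \<one>\<close>, layers acting on
  disjoint factors commute (\<open>interchange\<close>), and a comultiplied factor is carried through the
  permutation as one block, by naturality of the symmetry. This requires \<open>\<sigma>\<^sub>3\<close>, followed by the
  permutation from para-associativity, to be a composite of two block switches; that identity
  (\<open>sigma3_as_block_switches\<close>) follows from the Coxeter relations for adjacent switches.\<close>

section \<open>Morphisms between tensor powers of an object\<close>

locale object_powers = strict_symmetric_monoidal_category C
  for C :: "('o, 'm, 'z) smc_scheme" (structure) +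
  fixes X :: 'o
  assumes base_obj: "X \<in> Obj C"
begin

abbreviation pow :: "nat \<Rightarrow> 'o" where "pow n \<equiv> power_obj X n"

abbreviation arr :: "nat \<Rightarrow> nat \<Rightarrow> 'm \<Rightarrow> bool" where
  "arr m n f \<equiv> f \<in> Arr C \<and> Dom C f = pow m \<and> Cod C f = pow n"

text \<open>Every arrow below is a composite of layers. Indexing a layer by the numbers of idle factors on
  its two sides turns the bookkeeping of strict associativity into arithmetic.\<close>

definition layer :: "nat \<Rightarrow> 'm \<Rightarrow> nat \<Rightarrow> 'm" where
  "layer a f b = id_power X a \<otimes> f \<otimes> id_power X b"

abbreviation block_switch :: "nat \<Rightarrow> nat \<Rightarrow> 'm" where
  "block_switch m n \<equiv> \<tau> (pow m) (pow n)"

text \<open>Arities are compared by evaluating numerals, so \<open>1\<close> and \<open>2\<close> must not be unfolded into successors.\<close>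

declare power_obj.simps [simp del]
  One_nat_def [simp del] add_2_eq_Suc [simp del] add_2_eq_Suc' [simp del]

lemma pow_obj [simp]: "pow n \<in> Obj C"
  by (induction n) (simp_all add: power_obj.simps unit_obj base_obj tensor_obj)

lemma pow_add [simp]: "pow m \<odot> pow n = pow (m + n)"
  by (induction m)
     (simp_all add: power_obj.simps tensor_obj_unit_left tensor_obj_assoc base_obj)

lemma pow_1: "pow 1 = X"
  by (simp add: One_nat_def power_obj.simps tensor_obj_unit_right base_obj)

lemma id_power_arr [simp]: "arr n n (id_power X n)"
  using id_hom[of "pow n"] by (simp add: id_power_def in_hom_def)

lemma id_power_1: "id_power X 1 = \<one> X"
  by (simp add: id_power_def pow_1)

lemma comp_arr [simp]:
  assumes "f \<in> Arr C" "g \<in> Arr C" "Dom C g = Cod C f"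
  shows "g \<cdot> f \<in> Arr C" "Dom C (g \<cdot> f) = Dom C f" "Cod C (g \<cdot> f) = Cod C g"
  using comp_hom[of f "Dom C f" "Cod C f" g "Cod C g"] assms by (simp_all add: in_hom_def)

lemma tensor_arr [simp]:
  assumes "f \<in> Arr C" "g \<in> Arr C"
  shows "f \<otimes> g \<in> Arr C" "Dom C (f \<otimes> g) = Dom C f \<odot> Dom C g"
    "Cod C (f \<otimes> g) = Cod C f \<odot> Cod C g"
  using tensor_hom[of f "Dom C f" "Cod C f" g "Dom C g" "Cod C g"] assms
  by (simp_all add: in_hom_def)

lemma block_switch_arr [simp]: "arr (m + n) (m + n) (block_switch m n)"
  using switch_hom[of "pow m" "pow n"] by (simp add: in_hom_def add.commute)

lemma switch_arr [simp]: "arr 2 2 (\<tau> X X)"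
  using block_switch_arr[of 1 1] by (simp add: pow_1)

lemma comp_assoc_arr [simp]:
  "\<lbrakk>f \<in> Arr C; g \<in> Arr C; h \<in> Arr C; Dom C g = Cod C f; Dom C h = Cod C g\<rbrakk>
    \<Longrightarrow> (h \<cdot> g) \<cdot> f = h \<cdot> (g \<cdot> f)"
  using comp_assoc[of f "Dom C f" "Cod C f" g "Cod C g" h "Cod C h"] by (simp add: in_hom_def)

lemma id_power_comp [simp]:
  "f \<in> Arr C \<Longrightarrow> Cod C f = pow n \<Longrightarrow> id_power X n \<cdot> f = f"
  "f \<in> Arr C \<Longrightarrow> Dom C f = pow n \<Longrightarrow> f \<cdot> id_power X n = f"
  using id_left[of f "Dom C f" "pow n"] id_right[of f "pow n" "Cod C f"]
  by (simp_all add: in_hom_def id_power_def)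

lemma id_power_tensor [simp]: "id_power X m \<otimes> id_power X n = id_power X (m + n)"
  by (simp add: id_power_def tensor_id)

lemma id_power_tensor_assoc [simp]:
  "f \<in> Arr C \<Longrightarrow> id_power X m \<otimes> (id_power X n \<otimes> f) = id_power X (m + n) \<otimes> f"
  by (simp flip: tensor_assoc)

lemma id_power_0 [simp]:
  "f \<in> Arr C \<Longrightarrow> id_power X 0 \<otimes> f = f" "f \<in> Arr C \<Longrightarrow> f \<otimes> id_power X 0 = f"
  by (simp_all add: id_power_def power_obj.simps tensor_unit_left tensor_unit_right)

lemma tensor_comp_arr:
  "\<lbrakk>f \<in> Arr C; g \<in> Arr C; Dom C g = Cod C f; f' \<in> Arr C; g' \<in> Arr C; Dom C g' = Cod C f'\<rbrakk>
    \<Longrightarrow> (g \<otimes> g') \<cdot> (f \<otimes> f') = (g \<cdot> f) \<otimes> (g' \<cdot> f')"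
  using tensor_comp[of f "Dom C f" "Cod C f" g "Cod C g" f' "Dom C f'" "Cod C f'" g' "Cod C g'"]
  by (simp add: in_hom_def)

text \<open>Composites are kept right-nested; this lets an equation for \<open>g \<cdot> f\<close> rewrite the first two
  factors of a longer composite.\<close>

lemma comp_extend:
  "\<lbrakk>g \<cdot> f = h; f \<in> Arr C; g \<in> Arr C; t \<in> Arr C; Dom C g = Cod C f; Dom C f = Cod C t\<rbrakk>
    \<Longrightarrow> g \<cdot> (f \<cdot> t) = h \<cdot> t"
  by auto

lemma layer_arr [simp]:
  assumes "f \<in> Arr C"
  shows "layer a f b \<in> Arr C" "Dom C (layer a f b) = pow a \<odot> Dom C f \<odot> pow b"
    "Cod C (layer a f b) = pow a \<odot> Cod C f \<odot> pow b"
  using assms by (simp_all add: layer_def)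

lemma layer_id [simp]: "layer a (id_power X n) b = id_power X (a + n + b)"
  by (simp add: layer_def add.assoc)

lemma layer_0 [simp]: "f \<in> Arr C \<Longrightarrow> layer 0 f 0 = f"
  by (simp add: layer_def)

lemma layer_comp:
  "\<lbrakk>f \<in> Arr C; g \<in> Arr C; Dom C g = Cod C f\<rbrakk>
    \<Longrightarrow> layer a (g \<cdot> f) b = layer a g b \<cdot> layer a f b"
  by (simp add: layer_def tensor_comp_arr)

lemma layer_layer [simp]:
  "f \<in> Arr C \<Longrightarrow> layer a (layer c f d) b = layer (a + c) f (d + b)"
  by (simp add: layer_def tensor_assoc)

lemma tensor_eq_layers:
  assumes "arr m n f" "arr p q g"
  shows "f \<otimes> g = layer 0 f q \<cdot> layer m g 0"
    and "f \<otimes> g = layer n g 0 \<cdot> layer 0 f p"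
  using assms by (simp_all add: layer_def tensor_comp_arr)

text \<open>Layers on disjoint factors commute; \<open>k\<close> counts the idle factors between them, and the numbers
  of idle factors on either side shift with the arity of the other arrow.\<close>

lemma interchange:
  assumes "arr m n f" "arr p q g"
  shows "layer a f (k + q + b) \<cdot> layer (a + m + k) g b
       = layer (a + n + k) g b \<cdot> layer a f (k + p + b)"
proof -
  have kg: "arr (k + p) (k + q) (layer k g 0)"
    using assms by simp
  have "layer a (layer 0 f (k + q) \<cdot> layer m (layer k g 0) 0) b
      = layer a (layer n (layer k g 0) 0 \<cdot> layer 0 f (k + p)) b"
    using tensor_eq_layers[OF assms(1) kg] by simp
  then show ?thesis
    using assms by (simp add: layer_comp add.assoc)
qed

section \<open>Switches of blocks\<close>

lemma switch_eq_block: "\<tau> X X = block_switch 1 1"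
  by (simp add: pow_1)

lemma block_switch_symmetric: "block_switch n m \<cdot> block_switch m n = id_power X (m + n)"
  using switch_symmetric[of "pow m" "pow n"] by (simp add: id_power_def)

lemma switch_switch: "\<tau> X X \<cdot> \<tau> X X = id_power X 2"
  using block_switch_symmetric[of 1 1] by (simp add: pow_1)

lemma block_switch_natural_right:
  assumes "arr m n f"
  shows "block_switch p n \<cdot> layer p f 0 = layer 0 f p \<cdot> block_switch p m"
  using switch_natural[of "id_power X p" "pow p" "pow p" f "pow m" "pow n"] assms
  by (simp add: layer_def in_hom_def)

lemma block_switch_natural_left:
  assumes "arr m n f"
  shows "block_switch n p \<cdot> layer 0 f p = layer p f 0 \<cdot> block_switch m p"
  using switch_natural[of f "pow m" "pow n" "id_power X p" "pow p" "pow p"] assms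
  by (simp add: layer_def in_hom_def)

lemma block_switch_add_left:
  "block_switch (m + n) p = layer 0 (block_switch m p) n \<cdot> layer m (block_switch n p) 0"
  using switch_hexagon[of "pow m" "pow n" "pow p"] by (simp add: layer_def flip: id_power_def)

text \<open>The second hexagon is the first one inverted: the right-hand side is a right inverse of
  \<open>block_switch (m + n) p\<close>, of which the left-hand side is an inverse by symmetry.\<close>

lemma block_switch_add_right:
  "block_switch p (m + n) = layer m (block_switch p n) 0 \<cdot> layer 0 (block_switch p m) n"
    (is "?s = ?r")
proof -
  let ?l = "block_switch (m + n) p"
  have "?l \<cdot> ?r = layer 0 (block_switch m p) n \<cdot> layer m (block_switch n p \<cdot> block_switch p n) 0
      \<cdot> layer 0 (block_switch p m) n"
    by (simp add: block_switch_add_left layer_comp ac_simps)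
  also have "\<dots> = layer 0 (block_switch m p \<cdot> block_switch p m) n"
    by (simp add: block_switch_symmetric ac_simps flip: layer_comp)
  also have "\<dots> = id_power X (m + n + p)"
    by (simp add: block_switch_symmetric ac_simps)
  finally have lr: "?l \<cdot> ?r = id_power X (m + n + p)" .
  have "?r = (?s \<cdot> ?l) \<cdot> ?r"
    by (simp add: block_switch_symmetric ac_simps)
  also have "\<dots> = ?s \<cdot> (?l \<cdot> ?r)"
    by (rule comp_assoc_arr) (simp_all add: ac_simps)
  also have "\<dots> = ?s"
    by (simp add: lr ac_simps)
  finally show ?thesis ..
qed

text \<open>The hexagon for \<open>\<I> \<odot> \<I> = \<I>\<close> makes this switch idempotent, and an invertible idempotent is an
  identity.\<close>

lemma block_switch_0: "block_switch p 0 = id_power X p"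
proof -
  let ?l = "block_switch 0 p" and ?r = "block_switch p 0"
  have "?r = ?r \<cdot> ?r"
    using block_switch_add_right[of p 0 0] by simp
  moreover have "?l \<cdot> ?r = id_power X p"
    using block_switch_symmetric[of 0 p] by simp
  moreover have "?l \<cdot> (?r \<cdot> ?r) = (?l \<cdot> ?r) \<cdot> ?r"
    by simp
  ultimately show ?thesis by simp
qed

lemma block_switch_0_left: "block_switch 0 p = id_power X p"
  using block_switch_symmetric[of p 0] by (simp add: block_switch_0)

lemma block_switch_1_2:
  "block_switch 1 2 = layer 1 (\<tau> X X) 0 \<cdot> layer 0 (\<tau> X X) 1"
  using block_switch_add_right[of 1 1 1]
  by (simp add: pow_1)

lemma block_switch_2_1:
  "block_switch 2 1 = layer 0 (\<tau> X X) 1 \<cdot> layer 1 (\<tau> X X) 0"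
  using block_switch_add_left[of 1 1 1]
  by (simp add: pow_1)

text \<open>The Yang--Baxter relation is naturality of the switch of a pair past one factor, applied to the
  switch within the pair.\<close>

lemma braid:
  "layer 0 (\<tau> X X) 1 \<cdot> layer 1 (\<tau> X X) 0 \<cdot> layer 0 (\<tau> X X) 1
   = layer 1 (\<tau> X X) 0 \<cdot> layer 0 (\<tau> X X) 1 \<cdot> layer 1 (\<tau> X X) 0"
  using block_switch_natural_left[OF switch_arr, of 1]
  by (simp add: block_switch_2_1)

lemma block_switch_1_plus_2:
  "block_switch (1 + n) 2
   = layer 1 (\<tau> X X) n \<cdot> layer 0 (\<tau> X X) (1 + n) \<cdot> layer 1 (block_switch n 2) 0"
  using block_switch_add_left[of 1 n 2] by (simp add: block_switch_1_2 layer_comp)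

section \<open>The permutation of nine factors\<close>

abbreviation sw :: "nat \<Rightarrow> 'm" where "sw \<equiv> adjacent_switch X 9"

lemma sw_layer: "1 \<le> k \<Longrightarrow> sw k = layer (k - 1) (\<tau> X X) (9 - k - 1)"
  by (simp add: adjacent_switch_def layer_def)

lemma sw_layers:
  "sw 2 = layer 1 (\<tau> X X) 6" "sw 3 = layer 2 (\<tau> X X) 5" "sw 4 = layer 3 (\<tau> X X) 4"
  "sw 5 = layer 4 (\<tau> X X) 3" "sw 6 = layer 5 (\<tau> X X) 2" "sw 7 = layer 6 (\<tau> X X) 1"
  by (simp_all add: sw_layer One_nat_def)

lemma sw_arr [simp]: "1 \<le> k \<Longrightarrow> k \<le> 8 \<Longrightarrow> arr 9 9 (sw k)"
  by (simp add: sw_layer)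

text \<open>Combining the two typing conditions lets simplification check a long composite in one descent;
  as separate conditions each would trigger the other again at every factor.\<close>

definition into9 :: "'m \<Rightarrow> bool" where
  "into9 t \<longleftrightarrow> t \<in> Arr C \<and> Cod C t = pow 9"

lemma into9_sw [simp]: "1 \<le> k \<Longrightarrow> k \<le> 8 \<Longrightarrow> into9 t \<Longrightarrow> into9 (sw k \<cdot> t)"
  by (simp add: into9_def)

lemma into9_id [simp]: "into9 (id_power X 9)"
  by (simp add: into9_def)

text \<open>The three Coxeter relations, stated with a tail \<open>t\<close> so that they rewrite anywhere in a
  right-nested word.\<close>

lemma sw_cancel:
  assumes "1 \<le> k" "k \<le> 8" "into9 t"
  shows "sw k \<cdot> (sw k \<cdot> t) = t"
proof -
  have "sw k \<cdot> sw k = id_power X 9"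
    using assms by (simp add: sw_layer switch_switch flip: layer_comp)
  from comp_extend[OF this, of t] show ?thesis using assms by (simp add: into9_def)
qed

lemma sw_commute:
  assumes "1 \<le> j" "j + 2 \<le> k" "k \<le> 8" "into9 t"
  shows "sw k \<cdot> (sw j \<cdot> t) = sw j \<cdot> (sw k \<cdot> t)"
proof -
  define i d where "i = j - 1" and "d = k - j - 2"
  have j: "j - 1 = i" "9 - j - 1 = d + 2 + (9 - k - 1)" and k: "k - 1 = i + 2 + d"
    using assms by (simp_all add: i_def d_def)
  have "sw j \<cdot> sw k = sw k \<cdot> sw j"
    using interchange[OF switch_arr switch_arr, of i d "9 - k - 1"] assms
    by (simp only: sw_layer j k)
  from comp_extend[OF this[symmetric], of t] show ?thesis using assms by (simp add: into9_def)
qed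

lemma sw_braid:
  assumes "1 \<le> k" "k \<le> 7" "into9 t"
  shows "sw k \<cdot> (sw (k + 1) \<cdot> (sw k \<cdot> t)) = sw (k + 1) \<cdot> (sw k \<cdot> (sw (k + 1) \<cdot> t))"
proof -
  have "layer (k - 1) (layer 0 (\<tau> X X) 1 \<cdot> layer 1 (\<tau> X X) 0 \<cdot> layer 0 (\<tau> X X) 1) (8 - k - 1)
   = layer (k - 1) (layer 1 (\<tau> X X) 0 \<cdot> layer 0 (\<tau> X X) 1 \<cdot> layer 1 (\<tau> X X) 0) (8 - k - 1)"
    by (simp only: braid)
  then have "sw k \<cdot> sw (k + 1) \<cdot> sw k = sw (k + 1) \<cdot> sw k \<cdot> sw (k + 1)"
    using assms by (simp add: sw_layer layer_comp)
  then have "(sw k \<cdot> sw (k + 1) \<cdot> sw k) \<cdot> t = (sw (k + 1) \<cdot> sw k \<cdot> sw (k + 1)) \<cdot> t"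
    by simp
  then show ?thesis using assms by (simp add: into9_def)
qed

definition switches :: "nat list \<Rightarrow> 'm" where
  "switches ws = foldr (\<lambda>k f. sw k \<cdot> f) ws (id_power X 9)"

lemma switches_Nil: "switches [] = id_power X 9"
  and switches_Cons: "switches (k # ws) = sw k \<cdot> switches ws"
  by (simp_all add: switches_def)

lemma switches_arr [simp]: "set ws \<subseteq> {1..8} \<Longrightarrow> arr 9 9 (switches ws)"
  by (induction ws) (simp_all add: switches_Nil switches_Cons)

lemma switches_append:
  "set (u @ v) \<subseteq> {1..8} \<Longrightarrow> switches u \<cdot> switches v = switches (u @ v)"
  by (induction u) (simp_all add: switches_Nil switches_Cons)

lemma tau321_layers:
  "tau321 X = layer 1 (\<tau> X X) 2 \<cdot> layer 2 (\<tau> X X) 1 \<cdot> layer 1 (\<tau> X X) 2"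
  by (simp add: tau321_def layer_def id_power_def pow_1)

lemma tau321_arr [simp]: "arr 5 5 (tau321 X)"
  by (simp add: tau321_layers)

lemma sigma3_switches:
  "sigma3 X = switches [2, 3, 2, 3, 4, 5, 6, 5, 4, 3, 6, 7, 6]"
proof -
  have "transposition_word 2 4 = [2, 3, 2]" "transposition_word 3 7 = [3, 4, 5, 6, 5, 4, 3]"
    "transposition_word 6 8 = [6, 7, 6]"
    by (simp_all add: transposition_word_def)
  then show ?thesis
    by (simp only: sigma3_def transposition_arrow_def flip: switches_def)
       (simp add: switches_append)
qed

lemma layer_tau321_switches: "layer 2 (tau321 X) 2 = switches [4, 5, 4]"
  by (simp add: tau321_layers layer_comp sw_layers switches_Nil switches_Cons)

lemma block_switch_2_2:
  "block_switch 2 2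
   = layer 1 (\<tau> X X) 1 \<cdot> layer 0 (\<tau> X X) 2 \<cdot> layer 2 (\<tau> X X) 0 \<cdot> layer 1 (\<tau> X X) 1"
  using block_switch_1_plus_2[of 1] by (simp add: block_switch_1_2 layer_comp)

lemma layer_block_switch_2_2_switches:
  "layer 1 (block_switch 2 2) 4 = switches [3, 2, 4, 3]"
  by (simp add: block_switch_2_2 layer_comp sw_layers switches_Nil switches_Cons)

lemma layer_block_switch_4_2_switches:
  "layer 2 (block_switch 4 2) 1 = switches [4, 3, 5, 4, 6, 5, 7, 6]"
proof -
  have b3: "block_switch 3 2 = layer 1 (\<tau> X X) 2 \<cdot> layer 0 (\<tau> X X) 3 \<cdot> layer 1 (block_switch 2 2) 0"
    using block_switch_1_plus_2[of 2] by simp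
  have b4: "block_switch 4 2 = layer 1 (\<tau> X X) 3 \<cdot> layer 0 (\<tau> X X) 4 \<cdot> layer 1 (block_switch 3 2) 0"
    using block_switch_1_plus_2[of 3] by simp
  show ?thesis
    by (simp add: b3 b4 block_switch_2_2 layer_comp sw_layers switches_Nil switches_Cons)
qed

text \<open>On \<open>(x, y, z, u\<^sub>2, u\<^sub>1, u\<^sub>3, v\<^sub>2, v\<^sub>1, v\<^sub>3)\<close> both sides produce
  \<open>(x, u\<^sub>2, v\<^sub>2, v\<^sub>1, u\<^sub>1, y, z, u\<^sub>3, v\<^sub>3)\<close>. On the right, \<open>(y, z)\<close> first passes
  \<open>(u\<^sub>2, u\<^sub>1)\<close> and then \<open>(u\<^sub>1, y, z, u\<^sub>3)\<close> passes \<open>(v\<^sub>2, v\<^sub>1)\<close>, so that the two pairs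
  travel as blocks.\<close>

lemma sigma3_as_block_switches:
  "layer 2 (tau321 X) 2 \<cdot> sigma3 X
   = layer 2 (block_switch 4 2) 1 \<cdot> layer 1 (block_switch 2 2) 4"
proof -
  \<comment> \<open>Three braid moves and two cancellations shorten the word of length 16 to one of length 12;
     everything else commutes distant letters.\<close>
  have "layer 2 (tau321 X) 2 \<cdot> sigma3 X
     = switches [4, 5, 4, 2, 3, 2, 3, 4, 5, 6, 5, 4, 3, 6, 7, 6]"
    by (simp add: layer_tau321_switches sigma3_switches switches_append)
  also have "\<dots> = switches [4, 5, 4, 3, 2, 4, 5, 6, 5, 4, 3, 6, 7, 6]"
    by (simp add: switches_Nil switches_Cons sw_braid[of 2, simplified] sw_cancel del: id_power_comp)
  also have "\<dots> = switches [4, 5, 4, 3, 4, 2, 6, 5, 6, 4, 3, 6, 7, 6]"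
    by (simp add: switches_Nil switches_Cons sw_braid[of 5, simplified] sw_commute[of 2 4]
      del: id_power_comp)
  also have "\<dots> = switches [4, 5, 3, 4, 3, 2, 6, 5, 4, 3, 7, 6]"
    by (simp add: switches_Nil switches_Cons sw_braid[of 3, simplified]
      sw_commute[of 4 6] sw_commute[of 3 6] sw_cancel del: id_power_comp)
  also have "\<dots> = switches [4, 3, 5, 4, 6, 5, 7, 6, 3, 2, 4, 3]"
    by (simp add: switches_Nil switches_Cons sw_commute del: id_power_comp)
  also have "\<dots> = layer 2 (block_switch 4 2) 1 \<cdot> layer 1 (block_switch 2 2) 4"
    by (simp add: layer_block_switch_2_2_switches layer_block_switch_4_2_switches switches_append)
  finally show ?thesis .
qed

end

section \<open>Cancellation and degeneracy in heap objects\<close>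

sublocale comonoid_object \<subseteq> object_powers C X
  by unfold_locales (rule carrier_obj)

context comonoid_object begin

lemma comult_arr [simp]: "arr 1 2 \<Delta>"
  using comult_hom pow_add[of 1 1] by (simp add: in_hom_def pow_1)

lemma counit_arr [simp]: "arr 1 0 \<epsilon>"
  using counit_hom by (simp add: in_hom_def pow_1 power_obj.simps(1))

lemma layer_counit_left: "layer 0 \<epsilon> 1 \<cdot> \<Delta> = id_power X 1"
  using counit_left by (simp add: layer_def flip: id_power_1)

lemma layer_counit_right: "layer 1 \<epsilon> 0 \<cdot> \<Delta> = id_power X 1"
  using counit_right by (simp add: layer_def id_power_1)

end

context heap_object begin

lemma mult_arr [simp]: "arr 3 1 \<mu>"
proof -
  have "pow 3 = X \<odot> X \<odot> X"
    using pow_add[of 1 2] pow_add[of 1 1] by (simp add: pow_1)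
  then show ?thesis
    using mult_comonoid_morphism by (simp add: comonoid_morphism_def in_hom_def pow_1)
qed

lemma para_assoc_left: "\<mu> \<cdot> layer 0 \<mu> 2 = \<mu> \<cdot> layer 1 \<mu> 1 \<cdot> tau321 X"
  using para_associative_left by (simp add: layer_def id_power_1)

lemma para_assoc_right: "\<mu> \<cdot> layer 1 \<mu> 1 \<cdot> tau321 X = \<mu> \<cdot> layer 2 \<mu> 0"
  using para_associative_right by (simp add: layer_def id_power_1)

lemma degenerate_right: "\<mu> \<cdot> layer 1 \<Delta> 0 = layer 1 \<epsilon> 0"
  using degeneracy_right by (simp add: layer_def id_power_1)

lemma degenerate_left: "\<mu> \<cdot> layer 0 \<Delta> 1 = layer 0 \<epsilon> 1"
  using degeneracy_left by (simp add: layer_def flip: id_power_1)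

lemma counit_layer_left: "layer a \<epsilon> (1 + b) \<cdot> layer a \<Delta> b = id_power X (a + 1 + b)"
proof -
  have "layer a (layer 0 \<epsilon> 1 \<cdot> \<Delta>) b = id_power X (a + 1 + b)"
    by (simp only: layer_counit_left layer_id)
  then show ?thesis by (simp add: layer_comp)
qed

lemma counit_layer_right: "layer (a + 1) \<epsilon> b \<cdot> layer a \<Delta> b = id_power X (a + 1 + b)"
proof -
  have "layer a (layer 1 \<epsilon> 0 \<cdot> \<Delta>) b = id_power X (a + 1 + b)"
    by (simp only: layer_counit_right layer_id)
  then show ?thesis by (simp add: layer_comp)
qed

text \<open>The map \<open>\<chi>\<close> is recovered from \<open>[x, y, \<chi>(p, w)]\<close>: split its first input as \<open>p\<^sub>1 \<otimes> p\<^sub>2 \<otimes> p\<^sub>3\<close>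
  and feed the copies so that \<open>[p\<^sub>1, p\<^sub>2, \<chi>(p\<^sub>3, w)] = \<epsilon>(p\<^sub>1) \<chi>(p\<^sub>2, w) = \<chi>(p, w)\<close>. An
  object need not have points to insert in the two outer slots; copies of an input take their place.\<close>

lemma mult_third_slot_cancel:
  assumes \<phi>: "arr 2 1 \<phi>" and \<psi>: "arr 2 1 \<psi>" and eq: "\<mu> \<cdot> layer 2 \<phi> 0 = \<mu> \<cdot> layer 2 \<psi> 0"
  shows "\<phi> = \<psi>"
proof -
  have recover: "(\<mu> \<cdot> layer 2 \<chi> 0) \<cdot> layer 0 \<Delta> 2 \<cdot> layer 0 \<Delta> 1 = \<chi>" if \<chi>: "arr 2 1 \<chi>" for \<chi>
  proof -
    have e1: "layer 2 \<chi> 0 \<cdot> layer 0 \<Delta> 2 = layer 0 \<Delta> 1 \<cdot> layer 1 \<chi> 0"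
      using interchange[OF comult_arr \<chi>, of 0 0 0] by simp
    have e2: "layer 0 \<epsilon> 1 \<cdot> layer 1 \<chi> 0 = \<chi> \<cdot> layer 0 \<epsilon> 2"
      using interchange[OF counit_arr \<chi>, of 0 0 0] \<chi> by simp
    have "(\<mu> \<cdot> layer 2 \<chi> 0) \<cdot> layer 0 \<Delta> 2 \<cdot> layer 0 \<Delta> 1
        = \<mu> \<cdot> layer 0 \<Delta> 1 \<cdot> layer 1 \<chi> 0 \<cdot> layer 0 \<Delta> 1"
      using \<chi> by (simp add: comp_extend[OF e1])
    also have "\<dots> = layer 0 \<epsilon> 1 \<cdot> layer 1 \<chi> 0 \<cdot> layer 0 \<Delta> 1"
      using \<chi> by (simp add: comp_extend[OF degenerate_left])
    also have "\<dots> = \<chi> \<cdot> layer 0 \<epsilon> 2 \<cdot> layer 0 \<Delta> 1"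
      using \<chi> by (simp add: comp_extend[OF e2])
    also have "\<dots> = \<chi>"
      using \<chi> counit_layer_left[of 0 1] by simp
    finally show ?thesis .
  qed
  have "\<phi> = (\<mu> \<cdot> layer 2 \<phi> 0) \<cdot> layer 0 \<Delta> 2 \<cdot> layer 0 \<Delta> 1"
    by (rule recover[OF \<phi>, symmetric])
  also have "\<dots> = (\<mu> \<cdot> layer 2 \<psi> 0) \<cdot> layer 0 \<Delta> 2 \<cdot> layer 0 \<Delta> 1"
    by (simp only: eq)
  also have "\<dots> = \<psi>"
    by (rule recover[OF \<psi>])
  finally show ?thesis .
qed

text \<open>Mirror image: \<open>[\<chi>(w, p\<^sub>1), p\<^sub>2, p\<^sub>3] = \<chi>(w, p)\<close>.\<close>

lemma mult_first_slot_cancel: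
  assumes \<phi>: "arr 2 1 \<phi>" and \<psi>: "arr 2 1 \<psi>" and eq: "\<mu> \<cdot> layer 0 \<phi> 2 = \<mu> \<cdot> layer 0 \<psi> 2"
  shows "\<phi> = \<psi>"
proof -
  have recover: "(\<mu> \<cdot> layer 0 \<chi> 2) \<cdot> layer 2 \<Delta> 0 \<cdot> layer 1 \<Delta> 0 = \<chi>" if \<chi>: "arr 2 1 \<chi>" for \<chi>
  proof -
    have e1: "layer 0 \<chi> 2 \<cdot> layer 2 \<Delta> 0 = layer 1 \<Delta> 0 \<cdot> layer 0 \<chi> 1"
      using interchange[OF \<chi> comult_arr, of 0 0 0] by simp
    have e2: "layer 1 \<epsilon> 0 \<cdot> layer 0 \<chi> 1 = \<chi> \<cdot> layer 2 \<epsilon> 0"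
      using interchange[OF \<chi> counit_arr, of 0 0 0] \<chi> by simp
    have "(\<mu> \<cdot> layer 0 \<chi> 2) \<cdot> layer 2 \<Delta> 0 \<cdot> layer 1 \<Delta> 0
        = \<mu> \<cdot> layer 1 \<Delta> 0 \<cdot> layer 0 \<chi> 1 \<cdot> layer 1 \<Delta> 0"
      using \<chi> by (simp add: comp_extend[OF e1])
    also have "\<dots> = layer 1 \<epsilon> 0 \<cdot> layer 0 \<chi> 1 \<cdot> layer 1 \<Delta> 0"
      using \<chi> by (simp add: comp_extend[OF degenerate_right])
    also have "\<dots> = \<chi> \<cdot> layer 2 \<epsilon> 0 \<cdot> layer 1 \<Delta> 0"
      using \<chi> by (simp add: comp_extend[OF e2])
    also have "\<dots> = \<chi>"
      using \<chi> counit_layer_right[of 1 0] by simp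
    finally show ?thesis .
  qed
  have "\<phi> = (\<mu> \<cdot> layer 0 \<phi> 2) \<cdot> layer 2 \<Delta> 0 \<cdot> layer 1 \<Delta> 0"
    by (rule recover[OF \<phi>, symmetric])
  also have "\<dots> = (\<mu> \<cdot> layer 0 \<psi> 2) \<cdot> layer 2 \<Delta> 0 \<cdot> layer 1 \<Delta> 0"
    by (simp only: eq)
  also have "\<dots> = \<psi>"
    by (rule recover[OF \<psi>])
  finally show ?thesis .
qed

definition op_comult :: 'm where
  "op_comult = \<tau> X X \<cdot> \<Delta>"

lemma op_comult_arr [simp]: "arr 1 2 op_comult"
  by (simp add: op_comult_def)

lemma switch_op_comult: "\<tau> X X \<cdot> op_comult = \<Delta>"
  using comp_extend[OF switch_switch, of \<Delta>] by (simp add: op_comult_def)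

text \<open>Reversing \<open>(b, v\<^sub>2, v\<^sub>1)\<close> gives \<open>(v\<^sub>1, v\<^sub>2, b)\<close>: the opposite pair comes out in the order that
  the degeneracy axioms treat. To see it, the reversal is written so that it starts with the switch
  that undoes the opposite order, after which \<open>\<Delta>\<close> slides past \<open>b\<close> by naturality.\<close>

lemma tau321_op_comult_right:
  "tau321 X \<cdot> layer 2 op_comult 1 = layer 1 \<Delta> 2 \<cdot> layer 1 (\<tau> X X) 1"
proof -
  have "layer 1 (layer 0 (\<tau> X X) 1 \<cdot> layer 1 (\<tau> X X) 0 \<cdot> layer 0 (\<tau> X X) 1) 1
      = layer 1 (layer 1 (\<tau> X X) 0 \<cdot> layer 0 (\<tau> X X) 1 \<cdot> layer 1 (\<tau> X X) 0) 1"
    by (simp only: braid)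
  then have "tau321 X = layer 2 (\<tau> X X) 1 \<cdot> layer 1 (\<tau> X X) 2 \<cdot> layer 2 (\<tau> X X) 1"
    by (simp add: tau321_layers layer_comp)
  then have "tau321 X \<cdot> layer 2 op_comult 1
      = layer 2 (\<tau> X X) 1 \<cdot> layer 1 (\<tau> X X) 2 \<cdot> layer 2 (\<tau> X X \<cdot> op_comult) 1"
    by (simp add: layer_comp)
  also have "\<dots> = layer 1 (block_switch 1 2 \<cdot> layer 1 \<Delta> 0) 1"
    by (simp add: switch_op_comult block_switch_1_2 layer_comp)
  also have "\<dots> = layer 1 (layer 0 \<Delta> 1 \<cdot> \<tau> X X) 1"
    by (simp add: block_switch_natural_right[OF comult_arr] switch_eq_block)
  also have "\<dots> = layer 1 \<Delta> 2 \<cdot> layer 1 (\<tau> X X) 1"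
    by (simp add: layer_comp)
  finally show ?thesis .
qed

lemma tau321_op_comult_left:
  "tau321 X \<cdot> layer 1 op_comult 2 = layer 2 \<Delta> 1 \<cdot> layer 1 (\<tau> X X) 1"
proof -
  have "tau321 X \<cdot> layer 1 op_comult 2
      = layer 1 (\<tau> X X) 2 \<cdot> layer 2 (\<tau> X X) 1 \<cdot> layer 1 (\<tau> X X \<cdot> op_comult) 2"
    by (simp add: layer_comp tau321_layers)
  also have "\<dots> = layer 1 (block_switch 2 1 \<cdot> layer 0 \<Delta> 1) 1"
    by (simp add: switch_op_comult block_switch_2_1 layer_comp)
  also have "\<dots> = layer 1 (layer 1 \<Delta> 0 \<cdot> \<tau> X X) 1"
    by (simp add: block_switch_natural_left[OF comult_arr] switch_eq_block)
  also have "\<dots> = layer 2 \<Delta> 1 \<cdot> layer 1 (\<tau> X X) 1"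
    by (simp add: layer_comp)
  finally show ?thesis .
qed

lemma counit_switch_left: "layer 0 \<epsilon> 1 \<cdot> \<tau> X X = layer 1 \<epsilon> 0"
  using block_switch_natural_right[OF counit_arr, of 1]
  by (simp add: block_switch_0 switch_eq_block)

lemma counit_switch_right: "layer 1 \<epsilon> 0 \<cdot> \<tau> X X = layer 0 \<epsilon> 1"
  using block_switch_natural_left[OF counit_arr, of 1]
  by (simp add: block_switch_0_left switch_eq_block)

text \<open>\<open>[x, y, [v\<^sub>2, v\<^sub>1, z]] = [x, [v\<^sub>1, v\<^sub>2, y], z] = \<epsilon>(v) [x, y, z]\<close>, and \<open>[x, y, -]\<close> can be
  cancelled.\<close>

lemma op_degenerate_left: "\<mu> \<cdot> layer 0 op_comult 1 = layer 0 \<epsilon> 1"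
proof (rule mult_third_slot_cancel)
  have "\<mu> \<cdot> layer 2 (\<mu> \<cdot> layer 0 op_comult 1) 0
      = (\<mu> \<cdot> layer 2 \<mu> 0) \<cdot> layer 2 op_comult 1"
    by (simp add: layer_comp)
  also have "\<dots> = \<mu> \<cdot> layer 1 \<mu> 1 \<cdot> tau321 X \<cdot> layer 2 op_comult 1"
    by (simp flip: para_assoc_right)
  also have "\<dots> = \<mu> \<cdot> layer 1 ((\<mu> \<cdot> layer 0 \<Delta> 1) \<cdot> \<tau> X X) 1"
    by (simp add: tau321_op_comult_right layer_comp)
  also have "\<dots> = \<mu> \<cdot> layer 1 (layer 1 \<epsilon> 0) 1"
    by (simp only: degenerate_left counit_switch_left)
  finally show "\<mu> \<cdot> layer 2 (\<mu> \<cdot> layer 0 op_comult 1) 0 = \<mu> \<cdot> layer 2 (layer 0 \<epsilon> 1) 0"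
    by simp
qed simp_all

text \<open>\<open>[[x, u\<^sub>2, u\<^sub>1], y, z] = [x, [y, u\<^sub>1, u\<^sub>2], z] = \<epsilon>(u) [x, y, z]\<close>, and \<open>[-, y, z]\<close> can be
  cancelled.\<close>

lemma op_degenerate_right: "\<mu> \<cdot> layer 1 op_comult 0 = layer 1 \<epsilon> 0"
proof (rule mult_first_slot_cancel)
  have "\<mu> \<cdot> layer 0 (\<mu> \<cdot> layer 1 op_comult 0) 2
      = (\<mu> \<cdot> layer 0 \<mu> 2) \<cdot> layer 1 op_comult 2"
    by (simp add: layer_comp)
  also have "\<dots> = \<mu> \<cdot> layer 1 \<mu> 1 \<cdot> tau321 X \<cdot> layer 1 op_comult 2"
    by (simp add: para_assoc_left)
  also have "\<dots> = \<mu> \<cdot> layer 1 ((\<mu> \<cdot> layer 1 \<Delta> 0) \<cdot> \<tau> X X) 1"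
    by (simp add: tau321_op_comult_left layer_comp)
  also have "\<dots> = \<mu> \<cdot> layer 1 (layer 0 \<epsilon> 1) 1"
    by (simp only: degenerate_right counit_switch_right)
  finally show "\<mu> \<cdot> layer 0 (\<mu> \<cdot> layer 1 op_comult 0) 2 = \<mu> \<cdot> layer 0 (layer 1 \<epsilon> 0) 2"
    by simp
qed simp_all

section \<open>Self-distributivity\<close>

lemma para_assoc: "\<mu> \<cdot> layer 0 \<mu> 2 = \<mu> \<cdot> layer 2 \<mu> 0"
  by (rule trans[OF para_assoc_left para_assoc_right])

lemma tau321_involutive: "tau321 X \<cdot> tau321 X = id_power X 5"
proof -
  have c1: "layer 1 (\<tau> X X) 2 \<cdot> layer 1 (\<tau> X X) 2 = id_power X 5"
   and c2: "layer 2 (\<tau> X X) 1 \<cdot> layer 2 (\<tau> X X) 1 = id_power X 5"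
    by (simp_all add: switch_switch flip: layer_comp)
  show ?thesis
    by (simp add: tau321_layers comp_extend[OF c1] comp_extend[OF c2] c1)
qed

lemma para_assoc_middle: "\<mu> \<cdot> layer 1 \<mu> 1 = \<mu> \<cdot> layer 2 \<mu> 0 \<cdot> tau321 X"
proof -
  have "\<mu> \<cdot> layer 1 \<mu> 1 = (\<mu> \<cdot> layer 1 \<mu> 1 \<cdot> tau321 X) \<cdot> tau321 X"
    by (simp add: tau321_involutive)
  also have "\<dots> = \<mu> \<cdot> layer 2 \<mu> 0 \<cdot> tau321 X"
    by (simp only: para_assoc_right) simp
  finally show ?thesis .
qed

text \<open>\<open>[[x, p, q], [y, r, s], w] = [x, p, [q, [y, r, s], w]] = [x, p, [q, s, [r, y, w]]]\<close>, where \<open>w\<close>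
  is the third inner product.\<close>

lemma mult_of_mults:
  "\<mu> \<cdot> (\<mu> \<otimes> \<mu> \<otimes> \<mu>) = \<mu> \<cdot> layer 2 \<mu> 0 \<cdot> layer 4 \<mu> 0 \<cdot> layer 6 \<mu> 0 \<cdot> layer 2 (tau321 X) 2"
proof -
  \<comment> \<open>The permutation \<open>tau321\<close> fixes its last factor, which is the output of the third inner
     product; its restriction to the other four factors therefore slides past that product.\<close>
  define t where "t = layer 1 (\<tau> X X) 1 \<cdot> layer 2 (\<tau> X X) 0 \<cdot> layer 1 (\<tau> X X) 1"
  have t: "arr 4 4 t" by (simp add: t_def)
  have tau: "tau321 X = layer 0 t 1"
    by (simp add: tau321_layers t_def layer_comp)
  have slide: "layer 2 t 1 \<cdot> layer 6 \<mu> 0 = layer 6 \<mu> 0 \<cdot> layer 2 t 3"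
    using interchange[OF t mult_arr, of 2 0 0] by simp
  have "\<mu> \<otimes> \<mu> = layer 0 \<mu> 1 \<cdot> layer 3 \<mu> 0"
    by (rule tensor_eq_layers[OF mult_arr mult_arr])
  then have "\<mu> \<otimes> \<mu> \<otimes> \<mu> = layer 0 \<mu> 2 \<cdot> layer 3 \<mu> 1 \<cdot> layer 6 \<mu> 0"
    using tensor_eq_layers(1)[OF mult_arr, of "\<mu> \<otimes> \<mu>" 6 2] by (simp add: layer_comp)
  then have "\<mu> \<cdot> (\<mu> \<otimes> \<mu> \<otimes> \<mu>) = (\<mu> \<cdot> layer 0 \<mu> 2) \<cdot> layer 3 \<mu> 1 \<cdot> layer 6 \<mu> 0"
    by simp
  also have "\<dots> = \<mu> \<cdot> layer 2 (\<mu> \<cdot> layer 1 \<mu> 1) 0 \<cdot> layer 6 \<mu> 0"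
    by (simp only: para_assoc) (simp add: layer_comp)
  also have "\<dots> = \<mu> \<cdot> layer 2 \<mu> 0 \<cdot> layer 4 \<mu> 0 \<cdot> layer 2 t 1 \<cdot> layer 6 \<mu> 0"
    using t by (simp add: para_assoc_middle tau layer_comp)
  also have "\<dots> = \<mu> \<cdot> layer 2 \<mu> 0 \<cdot> layer 4 \<mu> 0 \<cdot> layer 6 \<mu> 0 \<cdot> layer 2 (tau321 X) 2"
    using t by (simp add: slide tau)
  finally show ?thesis .
qed

text \<open>\<open>[x, p, [v\<^sub>2, v\<^sub>1, w]] = \<epsilon>(v) [x, p, w]\<close>, with \<open>w\<close> itself a nested product: its two
  multiplications are moved out of the way before the deletion and back after it.\<close>

lemma nested_mult_absorbs_v:
  "\<mu> \<cdot> layer 2 \<mu> 0 \<cdot> layer 4 \<mu> 0 \<cdot> layer 6 \<mu> 0 \<cdot> layer 2 op_comult 5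
   = \<mu> \<cdot> layer 2 \<mu> 0 \<cdot> layer 4 \<mu> 0 \<cdot> layer 2 \<epsilon> 5"
proof -
  have s1: "layer 6 \<mu> 0 \<cdot> layer 2 op_comult 5 = layer 2 op_comult 3 \<cdot> layer 5 \<mu> 0"
    using interchange[OF op_comult_arr mult_arr, of 2 2 0] by simp
  have s2: "layer 4 \<mu> 0 \<cdot> layer 2 op_comult 3 = layer 2 op_comult 1 \<cdot> layer 3 \<mu> 0"
    using interchange[OF op_comult_arr mult_arr, of 2 0 0] by simp
  have s3: "layer 2 \<mu> 0 \<cdot> layer 2 op_comult 1 = layer 2 \<epsilon> 1"
  proof -
    have "layer 2 (\<mu> \<cdot> layer 0 op_comult 1) 0 = layer 2 \<epsilon> 1"
      by (simp add: op_degenerate_left)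
    then show ?thesis by (simp add: layer_comp)
  qed
  have s4: "layer 2 \<epsilon> 1 \<cdot> layer 3 \<mu> 0 = layer 2 \<mu> 0 \<cdot> layer 2 \<epsilon> 3"
    using interchange[OF counit_arr mult_arr, of 2 0 0] by simp
  have s5: "layer 2 \<epsilon> 3 \<cdot> layer 5 \<mu> 0 = layer 4 \<mu> 0 \<cdot> layer 2 \<epsilon> 5"
    using interchange[OF counit_arr mult_arr, of 2 2 0] by simp
  show ?thesis
    by (simp add: s1 comp_extend[OF s2] comp_extend[OF s3] comp_extend[OF s4] s5)
qed

text \<open>\<open>[x, u\<^sub>2, [u\<^sub>1, y, w]] = [[x, u\<^sub>2, u\<^sub>1], y, w] = \<epsilon>(u) [x, y, w]\<close>, with \<open>w\<close> itself a product.\<close>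

lemma nested_mult_absorbs_u:
  "\<mu> \<cdot> layer 2 \<mu> 0 \<cdot> layer 4 \<mu> 0 \<cdot> layer 1 op_comult 4 = \<mu> \<cdot> layer 2 \<mu> 0 \<cdot> layer 1 \<epsilon> 4"
proof -
  have s1: "layer 4 \<mu> 0 \<cdot> layer 1 op_comult 4 = layer 1 op_comult 2 \<cdot> layer 3 \<mu> 0"
    using interchange[OF op_comult_arr mult_arr, of 1 1 0] by simp
  have s2: "layer 0 \<mu> 2 \<cdot> layer 1 op_comult 2 = layer 1 \<epsilon> 2"
  proof -
    have "layer 0 (\<mu> \<cdot> layer 1 op_comult 0) 2 = layer 1 \<epsilon> 2"
      by (simp add: op_degenerate_right)
    then show ?thesis by (simp add: layer_comp)
  qed
  have s3: "layer 1 \<epsilon> 2 \<cdot> layer 3 \<mu> 0 = layer 2 \<mu> 0 \<cdot> layer 1 \<epsilon> 4"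
    using interchange[OF counit_arr mult_arr, of 1 1 0] by simp
  have "\<mu> \<cdot> layer 2 \<mu> 0 \<cdot> layer 4 \<mu> 0 \<cdot> layer 1 op_comult 4
      = (\<mu> \<cdot> layer 2 \<mu> 0) \<cdot> layer 1 op_comult 2 \<cdot> layer 3 \<mu> 0"
    by (simp add: s1)
  also have "\<dots> = \<mu> \<cdot> layer 0 \<mu> 2 \<cdot> layer 1 op_comult 2 \<cdot> layer 3 \<mu> 0"
    by (simp flip: para_assoc)
  also have "\<dots> = \<mu> \<cdot> layer 2 \<mu> 0 \<cdot> layer 1 \<epsilon> 4"
    by (simp add: comp_extend[OF s2] s3)
  finally show ?thesis .
qed

text \<open>The permutation \<open>(x, y, z, u\<^sub>2, u\<^sub>1, u\<^sub>3, V, v\<^sub>3) \<mapsto> (x, u\<^sub>2, V, u\<^sub>1, y, z, u\<^sub>3, v\<^sub>3)\<close> for a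
  block \<open>V\<close> of \<open>n\<close> factors. Leaving \<open>n\<close> open makes it natural in \<open>V\<close>: the cases 2, 1 and 0 are the
  opposite pair, the element that it came from, and its image under the counit.\<close>

definition move_v :: "nat \<Rightarrow> 'm" where
  "move_v n = layer 2 (block_switch 4 n) 1 \<cdot> layer 1 (block_switch 2 2) (2 + n)"

text \<open>The permutation \<open>(x, y, z, U, u\<^sub>3, v) \<mapsto> (x, U, y, z, u\<^sub>3, v)\<close> for a block \<open>U\<close> of \<open>n\<close> factors.
  For \<open>n = 2\<close> it is what remains of \<open>move_v\<close> when the block \<open>V\<close> is empty.\<close>

definition move_u :: "nat \<Rightarrow> 'm" where
  "move_u n = layer 1 (block_switch 2 n) 2"

lemma move_v_arr [simp]: "arr (7 + n) (7 + n) (move_v n)"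
  by (simp add: move_v_def ac_simps)

lemma move_u_arr [simp]: "arr (5 + n) (5 + n) (move_u n)"
  by (simp add: move_u_def ac_simps)

lemma move_v_natural:
  assumes f: "arr m n f"
  shows "move_v n \<cdot> layer 6 f 1 = layer 2 f 5 \<cdot> move_v m"
proof -
  have B: "arr 4 4 (block_switch 2 2)"
    using block_switch_arr[of 2 2] by simp
  have s1: "layer 1 (block_switch 2 2) (2 + n) \<cdot> layer 6 f 1
      = layer 6 f 1 \<cdot> layer 1 (block_switch 2 2) (2 + m)"
  proof -
    have "1 + n + 1 = 2 + n" "1 + m + 1 = 2 + m" "1 + 4 + 1 = (6::nat)"
      by simp_all
    then show ?thesis
      using interchange[OF B f, of 1 1 1] by (simp only:)
  qed
  have "layer 2 (block_switch 4 n \<cdot> layer 4 f 0) 1 = layer 2 (layer 0 f 4 \<cdot> block_switch 4 m) 1"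
    by (simp only: block_switch_natural_right[OF f])
  then have s2: "layer 2 (block_switch 4 n) 1 \<cdot> layer 6 f 1 = layer 2 f 5 \<cdot> layer 2 (block_switch 4 m) 1"
    using f by (simp add: layer_comp ac_simps)
  have "move_v n \<cdot> layer 6 f 1
      = layer 2 (block_switch 4 n) 1 \<cdot> layer 1 (block_switch 2 2) (2 + n) \<cdot> layer 6 f 1"
    using f by (simp add: move_v_def ac_simps)
  also have "\<dots> = layer 2 (block_switch 4 n) 1 \<cdot> layer 6 f 1 \<cdot> layer 1 (block_switch 2 2) (2 + m)"
    by (simp only: s1)
  also have "\<dots> = layer 2 f 5 \<cdot> move_v m"
    using f by (simp add: move_v_def comp_extend[OF s2] ac_simps)
  finally show ?thesis .
qed

lemma move_u_natural:
  assumes f: "arr m n f"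
  shows "move_u n \<cdot> layer 3 f 2 = layer 1 f 4 \<cdot> move_u m"
proof -
  have "layer 1 (block_switch 2 n \<cdot> layer 2 f 0) 2 = layer 1 (layer 0 f 2 \<cdot> block_switch 2 m) 2"
    by (simp only: block_switch_natural_right[OF f])
  then show ?thesis
    using f by (simp add: move_u_def layer_comp ac_simps)
qed

text \<open>Each of \<open>v\<close> and \<open>u\<close> in turn goes through the same cycle: pull the opposite comultiplication
  through the permutation, delete the pair next to the nested product, push the resulting counit back,
  and let it meet the remaining comultiplication.\<close>

lemma self_distributivity:
  "\<mu> \<cdot> (\<mu> \<otimes> \<mu> \<otimes> \<mu>) \<cdot> sigma3 X
     \<cdot> (id_power X 3 \<otimes> ((op_comult \<otimes> \<one> X) \<cdot> \<Delta>) \<otimes> ((op_comult \<otimes> \<one> X) \<cdot> \<Delta>))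
   = \<mu> \<cdot> (\<mu> \<otimes> id_power X 2)"
proof -
  let ?d = "layer 0 op_comult 1 \<cdot> \<Delta>"
  let ?M = "\<mu> \<cdot> layer 2 \<mu> 0 \<cdot> layer 4 \<mu> 0"
  have d: "(op_comult \<otimes> \<one> X) \<cdot> \<Delta> = ?d"
    by (simp add: layer_def flip: id_power_1)
  have d_arr: "arr 1 3 ?d" by simp
  have dd: "id_power X 3 \<otimes> ?d \<otimes> ?d = layer 6 op_comult 1 \<cdot> layer 6 \<Delta> 0 \<cdot> layer 3 ?d 1"
  proof -
    have "id_power X 3 \<otimes> ?d \<otimes> ?d = layer 3 (?d \<otimes> ?d) 0"
      by (simp add: layer_def)
    also have "\<dots> = layer 3 (layer 3 ?d 0 \<cdot> layer 0 ?d 1) 0"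
      by (simp only: tensor_eq_layers(2)[OF d_arr d_arr])
    finally show ?thesis by (simp add: layer_comp)
  qed
  have sigma: "arr 9 9 (sigma3 X)"
    by (simp add: sigma3_switches)
  have perm: "layer 2 (tau321 X) 2 \<cdot> sigma3 X = move_v 2"
    by (simp add: sigma3_as_block_switches move_v_def)
  have arrs: "arr 9 9 (move_v 2)" "arr 8 8 (move_v 1)" "arr 7 7 (move_v 0)"
     "arr 7 7 (move_u 2)" "arr 6 6 (move_u 1)" "arr 5 5 (move_u 0)"
    using move_v_arr[of 2] move_v_arr[of 1] move_v_arr[of 0]
      move_u_arr[of 2] move_u_arr[of 1] move_u_arr[of 0] by simp_all
  have move0: "move_v 0 = move_u 2" "move_u 0 = id_power X 5"
    using arrs by (simp_all add: move_v_def move_u_def block_switch_0)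
  have "\<mu> \<cdot> (\<mu> \<otimes> \<mu> \<otimes> \<mu>) \<cdot> sigma3 X \<cdot> (id_power X 3 \<otimes> ?d \<otimes> ?d)
      = (\<mu> \<cdot> (\<mu> \<otimes> \<mu> \<otimes> \<mu>)) \<cdot> sigma3 X \<cdot> layer 6 op_comult 1 \<cdot> layer 6 \<Delta> 0 \<cdot> layer 3 ?d 1"
    using sigma by (simp add: dd)
  also have "\<dots> = ?M \<cdot> layer 6 \<mu> 0 \<cdot> move_v 2 \<cdot> layer 6 op_comult 1 \<cdot> layer 6 \<Delta> 0 \<cdot> layer 3 ?d 1"
    using sigma arrs by (simp add: mult_of_mults comp_extend[OF perm])
  also have "\<dots> = (?M \<cdot> layer 6 \<mu> 0 \<cdot> layer 2 op_comult 5) \<cdot> move_v 1 \<cdot> layer 6 \<Delta> 0 \<cdot> layer 3 ?d 1"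
    using arrs by (simp add: comp_extend[OF move_v_natural[OF op_comult_arr]])
  also have "\<dots> = ?M \<cdot> (layer 2 \<epsilon> 5 \<cdot> move_v 1) \<cdot> layer 6 \<Delta> 0 \<cdot> layer 3 ?d 1"
    using arrs by (simp add: nested_mult_absorbs_v)
  also have "\<dots> = ?M \<cdot> move_u 2 \<cdot> (layer 6 \<epsilon> 1 \<cdot> layer 6 \<Delta> 0) \<cdot> layer 3 ?d 1"
    using arrs by (simp add: move_v_natural[OF counit_arr, symmetric] move0)
  also have "\<dots> = ?M \<cdot> move_u 2 \<cdot> layer 3 op_comult 2 \<cdot> layer 3 \<Delta> 1"
    using arrs counit_layer_left[of 6 0] by (simp add: layer_comp)
  also have "\<dots> = (?M \<cdot> layer 1 op_comult 4) \<cdot> move_u 1 \<cdot> layer 3 \<Delta> 1"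
    using arrs by (simp add: comp_extend[OF move_u_natural[OF op_comult_arr]])
  also have "\<dots> = (\<mu> \<cdot> layer 2 \<mu> 0) \<cdot> (layer 1 \<epsilon> 4 \<cdot> move_u 1) \<cdot> layer 3 \<Delta> 1"
    using arrs by (simp add: nested_mult_absorbs_u)
  also have "\<dots> = (\<mu> \<cdot> layer 2 \<mu> 0) \<cdot> layer 3 \<epsilon> 2 \<cdot> layer 3 \<Delta> 1"
    using arrs by (simp add: move_u_natural[OF counit_arr, symmetric] move0)
  also have "\<dots> = \<mu> \<cdot> layer 0 \<mu> 2"
    using counit_layer_left[of 3 1] by (simp add: para_assoc)
  finally show ?thesis
    by (simp only: d) (simp add: layer_def)
qed

end

theorem theorem7p12:
  fixes C :: "('o, 'm, 'z) smc_scheme" and X :: 'o and \<Delta> \<epsilon> \<mu> :: 'm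
  assumes "strict_symmetric_monoidal_category C"
    and "heap_object C X \<Delta> \<epsilon> \<mu>"
  shows "ternary_self_distributive_object C X \<Delta> \<epsilon> \<mu>"
proof -
  interpret heap_object C X \<Delta> \<epsilon> \<mu> by fact
  have "in_hom C \<mu> (X \<odot>\<^bsub>C\<^esub> X \<odot>\<^bsub>C\<^esub> X) X"
    using mult_comonoid_morphism by (simp add: comonoid_morphism_def)
  then show ?thesis
    using self_distributivity
    by unfold_locales (simp_all add: Let_def op_comult_def)
qed

end
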